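(* Let $m\ge 2$, $n\ge 1$ and $\mathcal{B}=(b_{i_1\cdots i_m})\in T_{m,n}$. If $\mathcal{B}$ is a B tensor (respectively, a B$_0$ tensor), then every principal sub-tensor of $\mathcal{B}$ is also a B tensor (respectively, a B$_0$ tensor).
   Context: $I_n=\{1,\dots,n\}$. $T_{m,n}$ is the set of real $m$th order $n$-dimensional tensors $\mathcal{B}=(b_{i_1\cdots i_m})$, $i_1,\dots,i_m\in I_n$. $\mathcal{B}\in T_{m,n}$ is a B tensor if for all $i\in I_n$: $\sum_{i_2,\dots,i_m=1}^n b_{ii_2\cdots i_m}>0$ and $\frac{1}{n^{m-1}}\sum_{i_2,\dots,i_m=1}^n b_{ii_2\cdots i_m}>b_{ij_2\cdots j_m}$ for all $(j_2,\dots,j_m)\ne(i,\dots,i)$ with $j_2,\dots,j_m\in I_n$. $\mathcal{B}$ is a B$_0$ tensor if the same conditions hold with both "$>$" replaced by "$\ge$". For a subset $J\subset I_n$ with $|J|=r$, $1\le r\le n$, the principal sub-tensor $\mathcal{B}^J_r\in T_{m,r}$ of $\mathcal{B}$ is the tensor $(b_{i_1\cdots i_m})_{i_1,\dots,i_m\in J}$, with indices ranging over $J$; the B and B$_0$ properties of $\mathcal{B}^J_r$ are understood with index set $J$ in place of $I_n$ and $r$ in place of $n$. *)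

theory Defs
  imports Complex_Main "HOL-Library.FuncSet"
begin

text \<open>
  An index tuple \<open>(i\<^sub>1, \<dots>, i\<^sub>k)\<close> is a list of length \<open>k\<close>. A real tensor of order \<open>m\<close> over a
  finite index set \<open>I\<close> is a function on the tuples of length \<open>m\<close> over \<open>I\<close>, extensional outside
  them; the space \<open>T\<^sub>m\<^sub>,\<^sub>n\<close> is the case \<open>I = {1..n}\<close>. The index set is kept as a parameter because
  a principal sub-tensor retains its original indices \<open>J\<close> instead of being renumbered to
  \<open>{1..r}\<close>.
\<close>

definition index_tuples :: "nat \<Rightarrow> nat set \<Rightarrow> nat list set" where
  "index_tuples k I = {is. length is = k \<and> set is \<subseteq> I}"

definition tensors :: "nat \<Rightarrow> nat set \<Rightarrow> (nat list \<Rightarrow> real) set" where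
  "tensors m I = (index_tuples m I \<rightarrow>\<^sub>E UNIV)"

definition principal_subtensor ::
    "nat \<Rightarrow> (nat list \<Rightarrow> real) \<Rightarrow> nat set \<Rightarrow> (nat list \<Rightarrow> real)" where
  "principal_subtensor m B J = restrict B (index_tuples m J)"

lemma principal_subtensor_in_tensors: "principal_subtensor m B J \<in> tensors m J"
  by (simp add: principal_subtensor_def tensors_def)

text \<open>
  In the next two definitions \<open>card I\<close> is the dimension, and the tuple \<open>(i, \<dots>, i)\<close> of length
  \<open>m - 1\<close> is \<open>replicate (m - 1) i\<close>.
\<close>

definition B_tensor :: "nat \<Rightarrow> nat set \<Rightarrow> (nat list \<Rightarrow> real) \<Rightarrow> bool" where
  "B_tensor m I B \<longleftrightarrow> B \<in> tensors m I \<and>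
     (\<forall>i\<in>I.
        (\<Sum>is\<in>index_tuples (m - 1) I. B (i # is)) > 0 \<and>
        (\<forall>js\<in>index_tuples (m - 1) I. js \<noteq> replicate (m - 1) i \<longrightarrow>
           1 / real (card I) ^ (m - 1) * (\<Sum>is\<in>index_tuples (m - 1) I. B (i # is)) > B (i # js)))"

definition B0_tensor :: "nat \<Rightarrow> nat set \<Rightarrow> (nat list \<Rightarrow> real) \<Rightarrow> bool" where
  "B0_tensor m I B \<longleftrightarrow> B \<in> tensors m I \<and>
     (\<forall>i\<in>I.
        (\<Sum>is\<in>index_tuples (m - 1) I. B (i # is)) \<ge> 0 \<and>
        (\<forall>js\<in>index_tuples (m - 1) I. js \<noteq> replicate (m - 1) i \<longrightarrow>
           1 / real (card I) ^ (m - 1) * (\<Sum>is\<in>index_tuples (m - 1) I. B (i # is)) \<ge> B (i # js)))"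

end

theory Submission
  imports Defs
begin

text \<open>
  Fix a row \<open>i \<in> J\<close>. The entries of row \<open>i\<close> that are dropped in passing to the sub-tensor are
  off-diagonal, hence at most the average of the row. Dropping them cannot decrease the
  average, so the row average of the sub-tensor is at least the row average of \<open>B\<close>, which is
  positive and exceeds all off-diagonal entries (with weak inequalities in the \<open>B\<^sub>0\<close> case).
\<close>

lemma finite_index_tuples: "finite I \<Longrightarrow> finite (index_tuples k I)"
  using finite_lists_length_eq[of I k] by (simp add: index_tuples_def conj_commute)

lemma card_index_tuples: "finite I \<Longrightarrow> card (index_tuples k I) = card I ^ k"
  using card_lists_length_eq[of I k] by (simp add: index_tuples_def conj_commute)

lemma index_tuples_mono: "J \<subseteq> I \<Longrightarrow> index_tuples k J \<subseteq> index_tuples k I"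
  by (auto simp: index_tuples_def)

lemma replicate_in_index_tuples: "i \<in> I \<Longrightarrow> replicate k i \<in> index_tuples k I"
  by (auto simp: index_tuples_def)

text \<open>Subtraction on naturals is truncated: \<open>m \<ge> 1\<close> ensures
  \<open>Suc (m - 1) = m\<close>, whereas for \<open>m = 0\<close> the tuple \<open>i # js\<close>
  would have length 1.\<close>

lemma Cons_in_index_tuples:
  "m \<ge> 1 \<Longrightarrow> i \<in> I \<Longrightarrow> js \<in> index_tuples (m - 1) I \<Longrightarrow> i # js \<in> index_tuples m I"
  by (auto simp: index_tuples_def)

text \<open>With \<open>a\<close> the average over \<open>A\<close>, the total is
  \<open>card A * a\<close>, and the dropped part \<open>A - C\<close> accounts for at most
  \<open>(card A - card C) * a\<close> of it. At least \<open>card C * a\<close> therefore remains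
  on \<open>C\<close>.\<close>

lemma average_le_average_subset:
  fixes f :: "'a \<Rightarrow> real"
  assumes A: "finite A" and C: "C \<subseteq> A" "C \<noteq> {}"
    and le: "\<And>x. x \<in> A - C \<Longrightarrow> f x \<le> 1 / real (card A) * sum f A"
  shows "1 / real (card A) * sum f A \<le> 1 / real (card C) * sum f C"
proof -
  define a where "a = 1 / real (card A) * sum f A"
  have pos: "card C > 0" "card A > 0"
    using A C by (auto simp: card_gt_0_iff intro: finite_subset)
  have "sum f (A - C) \<le> real (card (A - C)) * a"
    using sum_bounded_above[of "A - C" f a] le by (simp add: a_def)
  moreover have "sum f A = sum f (A - C) + sum f C"
    using A C by (simp add: sum.subset_diff)
  moreover have "real (card (A - C)) = real (card A) - real (card C)"
    using A C by (simp add: card_Diff_subset finite_subset card_mono of_nat_diff)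
  moreover have "sum f A = real (card A) * a"
    using pos by (simp add: a_def)
  ultimately have "real (card C) * a \<le> sum f C"
    by (simp add: algebra_simps)
  then show ?thesis
    using pos unfolding a_def[symmetric] by (simp add: field_simps)
qed

text \<open>Since \<open>i \<in> J\<close>, the diagonal tuple \<open>replicate k i\<close> survives
  in \<open>index_tuples k J\<close>. Hence this set is nonempty and every dropped tuple is
  off-diagonal, so that \<open>le\<close> bounds its entry. The powers of \<open>card I\<close> and
  \<open>card J\<close> are the numbers of tuples being averaged over.\<close>

lemma row_average_le_subtensor_row_average:
  fixes B :: "nat list \<Rightarrow> real"
  assumes "finite I" "J \<subseteq> I" "i \<in> J"
    and le: "\<And>js. js \<in> index_tuples k I \<Longrightarrow> js \<noteq> replicate k i \<Longrightarrow>
      B (i # js) \<le> 1 / real (card I) ^ k * (\<Sum>is\<in>index_tuples k I. B (i # is))"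
  shows "1 / real (card I) ^ k * (\<Sum>is\<in>index_tuples k I. B (i # is))
    \<le> 1 / real (card J) ^ k * (\<Sum>is\<in>index_tuples k J. B (i # is))"
proof -
  have "finite J"
    using assms finite_subset by blast
  with average_le_average_subset[of "index_tuples k I" "index_tuples k J" "\<lambda>js. B (i # js)"]
  show ?thesis
    using assms replicate_in_index_tuples[of i J k] index_tuples_mono[of J I k]
    by (fastforce simp: card_index_tuples finite_index_tuples)
qed

text \<open>Every \<open>i # is\<close> occurring here has all its indices in \<open>J\<close>,
  where the restriction agrees with \<open>B\<close>.\<close>

lemma sum_principal_subtensor_row:
  assumes "m \<ge> 1" "i \<in> J"
  shows "(\<Sum>is\<in>index_tuples (m - 1) J. principal_subtensor m B J (i # is))
    = (\<Sum>is\<in>index_tuples (m - 1) J. B (i # is))"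
  using assms by (intro sum.cong) (simp_all add: principal_subtensor_def Cons_in_index_tuples)

lemma B_tensor_principal_subtensor:
  assumes B: "B_tensor m I B" and "m \<ge> 1" "finite I" "J \<subseteq> I"
  shows "B_tensor m J (principal_subtensor m B J)"
  unfolding B_tensor_def
proof (intro conjI ballI impI)
  fix i assume i: "i \<in> J"
  let ?a = "1 / real (card I) ^ (m - 1) * (\<Sum>is\<in>index_tuples (m - 1) I. B (i # is))"
  let ?S = "\<Sum>is\<in>index_tuples (m - 1) J. B (i # is)"
  have J: "card I > 0" "card J > 0"
    using assms i by (auto simp: card_gt_0_iff intro: finite_subset)
  have row: "(\<Sum>is\<in>index_tuples (m - 1) I. B (i # is)) > 0"
    and off: "\<And>js. js \<in> index_tuples (m - 1) I \<Longrightarrow> js \<noteq> replicate (m - 1) i \<Longrightarrow> B (i # js) < ?a"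
    using B i \<open>J \<subseteq> I\<close> by (auto simp: B_tensor_def)
  \<comment> \<open>The comparison of averages is weak; strictness re-enters below through
    \<open>?a > 0\<close> and \<open>B (i # js) < ?a\<close>.\<close>
  have avg: "?a \<le> 1 / real (card J) ^ (m - 1) * ?S"
    using assms i off by (intro row_average_le_subtensor_row_average) (auto intro: less_imp_le)
  moreover have "?a > 0"
    using row J by simp
  ultimately have "1 / real (card J) ^ (m - 1) * ?S > 0"
    by linarith
  then have "?S > 0"
    using J by (simp add: zero_less_divide_iff)
  then show "(\<Sum>is\<in>index_tuples (m - 1) J. principal_subtensor m B J (i # is)) > 0"
    unfolding sum_principal_subtensor_row[OF \<open>m \<ge> 1\<close> i] .
  fix js assume js: "js \<in> index_tuples (m - 1) J" "js \<noteq> replicate (m - 1) i"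
  then have "B (i # js) < ?a"
    using off index_tuples_mono[OF \<open>J \<subseteq> I\<close>] by blast
  with avg have "B (i # js) < 1 / real (card J) ^ (m - 1) * ?S"
    by linarith
  then show "principal_subtensor m B J (i # js) < 1 / real (card J) ^ (m - 1) *
      (\<Sum>is\<in>index_tuples (m - 1) J. principal_subtensor m B J (i # is))"
    using assms i js
    unfolding sum_principal_subtensor_row[OF \<open>m \<ge> 1\<close> i]
    by (simp add: principal_subtensor_def Cons_in_index_tuples)
qed (rule principal_subtensor_in_tensors)

text \<open>The same chain of inequalities as for B tensors, with \<open>?a\<close> as the
  intermediate bound and every link weak.\<close>

lemma B0_tensor_principal_subtensor:
  assumes B: "B0_tensor m I B" and "m \<ge> 1" "finite I" "J \<subseteq> I"
  shows "B0_tensor m J (principal_subtensor m B J)"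
  unfolding B0_tensor_def
proof (intro conjI ballI impI)
  fix i assume i: "i \<in> J"
  let ?a = "1 / real (card I) ^ (m - 1) * (\<Sum>is\<in>index_tuples (m - 1) I. B (i # is))"
  let ?S = "\<Sum>is\<in>index_tuples (m - 1) J. B (i # is)"
  have J: "card J > 0"
    using assms i by (auto simp: card_gt_0_iff intro: finite_subset)
  have row: "(\<Sum>is\<in>index_tuples (m - 1) I. B (i # is)) \<ge> 0"
    and off: "\<And>js. js \<in> index_tuples (m - 1) I \<Longrightarrow> js \<noteq> replicate (m - 1) i \<Longrightarrow> B (i # js) \<le> ?a"
    using B i \<open>J \<subseteq> I\<close> by (auto simp: B0_tensor_def)
  have avg: "?a \<le> 1 / real (card J) ^ (m - 1) * ?S"
    using assms i off by (intro row_average_le_subtensor_row_average) auto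
  moreover have "?a \<ge> 0"
    using row by simp
  ultimately have "1 / real (card J) ^ (m - 1) * ?S \<ge> 0"
    by linarith
  \<comment> \<open>The sign rule for quotients leaves a second case with a nonpositive denominator,
    which \<open>card J > 0\<close> excludes.\<close>
  then have "?S \<ge> 0"
    using J by (auto simp: zero_le_divide_iff power_le_zero_eq)
  then show "(\<Sum>is\<in>index_tuples (m - 1) J. principal_subtensor m B J (i # is)) \<ge> 0"
    unfolding sum_principal_subtensor_row[OF \<open>m \<ge> 1\<close> i] .
  fix js assume js: "js \<in> index_tuples (m - 1) J" "js \<noteq> replicate (m - 1) i"
  then have "B (i # js) \<le> ?a"
    using off index_tuples_mono[OF \<open>J \<subseteq> I\<close>] by blast
  with avg have "B (i # js) \<le> 1 / real (card J) ^ (m - 1) * ?S"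
    by linarith
  then show "principal_subtensor m B J (i # js) \<le> 1 / real (card J) ^ (m - 1) *
      (\<Sum>is\<in>index_tuples (m - 1) J. principal_subtensor m B J (i # is))"
    using assms i js
    unfolding sum_principal_subtensor_row[OF \<open>m \<ge> 1\<close> i]
    by (simp add: principal_subtensor_def Cons_in_index_tuples)
qed (rule principal_subtensor_in_tensors)

theorem theorem5p4:
  fixes m n :: nat and B :: "nat list \<Rightarrow> real"
  assumes "m \<ge> 2" and "n \<ge> 1" and "B \<in> tensors m {1..n}"
  shows "(B_tensor m {1..n} B \<longrightarrow>
            (\<forall>r J. J \<subseteq> {1..n} \<and> card J = r \<and> 1 \<le> r \<and> r \<le> n \<longrightarrow>
               B_tensor m J (principal_subtensor m B J))) \<and>
         (B0_tensor m {1..n} B \<longrightarrow>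
            (\<forall>r J. J \<subseteq> {1..n} \<and> card J = r \<and> 1 \<le> r \<and> r \<le> n \<longrightarrow>
               B0_tensor m J (principal_subtensor m B J)))"
  \<comment> \<open>The number \<open>r\<close> only names \<open>card J\<close>, the dimension
    already built into the definitions over \<open>J\<close>.\<close>
  using assms B_tensor_principal_subtensor[of m "{1..n}" B]
    B0_tensor_principal_subtensor[of m "{1..n}" B]
  by simp

end
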